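(* For all problems $f,g:\subseteq\mathbb{N}^{\mathbb{N}}\rightrightarrows\mathbb{N}^{\mathbb{N}}$, if $\mathsf{tJ}(f)\le_{\mathrm W}\mathsf{tJ}(g)$ then $f\le_{\mathrm W} g$. Consequently, the map induced by $\mathsf{tJ}$ on the Weihrauch degrees is an injective endomorphism of the Weihrauch degrees (as a partial order).
   Context: A problem is a partial multi-valued function $f:\subseteq\mathbb{N}^{\mathbb{N}}\rightrightarrows\mathbb{N}^{\mathbb{N}}$, with $\mathrm{dom}(f)=\{p: f(p)\ne\emptyset\}$. $f\le_{\mathrm W} g$ means there are partial computable functionals $\Phi:\subseteq\mathbb{N}^{\mathbb{N}}\to\mathbb{N}^{\mathbb{N}}$ and $\Psi:\subseteq\mathbb{N}^{\mathbb{N}}\times\mathbb{N}^{\mathbb{N}}\to\mathbb{N}^{\mathbb{N}}$ such that for every $p\in\mathrm{dom}(f)$: $\Phi(p)\in\mathrm{dom}(g)$ and $\Psi(p,q)\in f(p)$ for every $q\in g(\Phi(p))$. $f\equiv_{\mathrm W} g$ means $f\le_{\mathrm W} g$ and $g\le_{\mathrm W} f$; the Weihrauch degrees are the equivalence classes, partially ordered by $\le_{\mathrm W}$. Finite products of copies of $\mathbb{N}$ and $\mathbb{N}^{\mathbb{N}}$ are identified with $\mathbb{N}^{\mathbb{N}}$ via standard computable codings. $(\Phi_e)_{e\in\mathbb{N}}$ is a fixed standard computable enumeration of the partial computable functionals on $\mathbb{N}^{\mathbb{N}}$; $\Phi_i(p,q)$ means $\Phi_i$ applied to the pair $(p,q)$;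 $\downarrow$ means defined. Tot-jump: for $e,i\in\mathbb{N}$, $p\in\mathbb{N}^{\mathbb{N}}$, $\mathsf{tJ}(f)(e,i,p)=\{\Phi_i(p,q): q\in f(\Phi_e(p))\}$ if $\Phi_e(p)\in\mathrm{dom}(f)$ and $\Phi_i(p,q)\downarrow$ for all $q\in f(\Phi_e(p))$; otherwise $\mathsf{tJ}(f)(e,i,p)=\mathbb{N}^{\mathbb{N}}$. *)

theory Defs
  imports Main "HOL-Library.Nat_Bijection"
begin

section \<open>Partial computable functionals on Baire space\<close>

type_synonym baire = "nat \<Rightarrow> nat"

text \<open>Programs for partial recursive functions of one number relative to an oracle. Tuples of
  numbers are passed around with the Cantor pairing \<^const>\<open>prod_encode\<close>.\<close>

datatype prog =
    Zero | Succ | Fst | Snd | Oracle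
  | Pair prog prog
  | Comp prog prog
  | Rec prog prog
  | Mu prog

text \<open>\<open>Comp c d\<close> runs \<open>d\<close> first. \<open>Rec c d\<close> is primitive recursion in the second component of the
  input, \<open>h(a,0) = c(a)\<close> and \<open>h(a,m+1) = d(a,(m,h(a,m)))\<close>. \<open>Mu c\<close> is unbounded search: it returns
  the \<open>n\<close> with \<open>c(x,n) = 0\<close> such that \<open>c(x,m)\<close> is defined and nonzero for all \<open>m < n\<close>.\<close>

primrec run :: "baire \<Rightarrow> prog \<Rightarrow> nat \<Rightarrow> nat option" where
  "run p Zero x = Some 0"
| "run p Succ x = Some (Suc x)"
| "run p Fst x = Some (fst (prod_decode x))"
| "run p Snd x = Some (snd (prod_decode x))"
| "run p Oracle x = Some (p x)"
| "run p (Pair c d) x =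
     Option.bind (run p c x) (\<lambda>u. Option.bind (run p d x) (\<lambda>v. Some (prod_encode (u, v))))"
| "run p (Comp c d) x = Option.bind (run p d x) (run p c)"
| "run p (Rec c d) x =
     (let a = fst (prod_decode x) in
      rec_nat (run p c a)
        (\<lambda>m r. Option.bind r (\<lambda>v. run p d (prod_encode (a, prod_encode (m, v)))))
        (snd (prod_decode x)))"
| "run p (Mu c) x =
     (let found = (\<lambda>n. run p c (prod_encode (x, n)) = Some 0 \<and>
                      (\<forall>m<n. \<exists>v. run p c (prod_encode (x, m)) = Some (Suc v)))
      in if \<exists>n. found n then Some (LEAST n. found n) else None)"

text \<open>On the oracle \<open>p\<close> a program outputs the sequence of its values on \<open>0, 1, 2, \<dots>\<close>; this is
  defined only if all of these computations halt.\<close>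

definition functional :: "prog \<Rightarrow> (baire \<rightharpoonup> baire)" where
  "functional c p = (if \<forall>n. run p c n \<noteq> None then Some (\<lambda>n. the (run p c n)) else None)"

definition partial_computable :: "(baire \<rightharpoonup> baire) \<Rightarrow> bool" where
  "partial_computable F \<longleftrightarrow> (\<exists>c. F = functional c)"

text \<open>Goedel numbering: the residue modulo 9 is the outermost constructor, the quotient codes the
  arguments.\<close>

lemma prod_decode_le: "fst (prod_decode k) \<le> k" "snd (prod_decode k) \<le> k"
  by (metis le_prod_encode_1 le_prod_encode_2 prod.collapse prod_decode_inverse)+

function prog_of :: "nat \<Rightarrow> prog" where
  "prog_of n =
     (let t = n mod 9; k = n div 9 in
      if t = 0 then Zero
      else if t = 1 then Succ
      else if t = 2 then Fst
      else if t = 3 then Snd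
      else if t = 4 then Oracle
      else if t = 5 then Pair (prog_of (fst (prod_decode k))) (prog_of (snd (prod_decode k)))
      else if t = 6 then Comp (prog_of (fst (prod_decode k))) (prog_of (snd (prod_decode k)))
      else if t = 7 then Rec (prog_of (fst (prod_decode k))) (prog_of (snd (prod_decode k)))
      else Mu (prog_of k))"
  by auto
termination
proof -
  have less: "n div 9 < n" if "n mod 9 \<noteq> 0" for n :: nat
    using that by (cases "n = 0") auto
  show ?thesis
    by (relation "measure id") (auto intro: le_less_trans[OF prod_decode_le(1) less]
        le_less_trans[OF prod_decode_le(2) less] less)
qed

declare prog_of.simps [simp del]

primrec prog_code :: "prog \<Rightarrow> nat" where
  "prog_code Zero = 0"
| "prog_code Succ = 1"
| "prog_code Fst = 2"
| "prog_code Snd = 3"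
| "prog_code Oracle = 4"
| "prog_code (Pair c d) = 9 * prod_encode (prog_code c, prog_code d) + 5"
| "prog_code (Comp c d) = 9 * prod_encode (prog_code c, prog_code d) + 6"
| "prog_code (Rec c d) = 9 * prod_encode (prog_code c, prog_code d) + 7"
| "prog_code (Mu c) = 9 * prog_code c + 8"

lemma prog_of_prog_code: "prog_of (prog_code c) = c"
proof (induction c)
  case (Pair c d)
  have "(9 * k + 5) mod 9 = 5" "(9 * k + 5) div 9 = k" for k :: nat by presburger+
  with Pair show ?case by (subst prog_of.simps) (simp add: Let_def)
next
  case (Comp c d)
  have "(9 * k + 6) mod 9 = 6" "(9 * k + 6) div 9 = k" for k :: nat by presburger+
  with Comp show ?case by (subst prog_of.simps) (simp add: Let_def)
next
  case (Rec c d)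
  have "(9 * k + 7) mod 9 = 7" "(9 * k + 7) div 9 = k" for k :: nat by presburger+
  with Rec show ?case by (subst prog_of.simps) (simp add: Let_def)
next
  case (Mu c)
  have "(9 * k + 8) mod 9 = 8" "(9 * k + 8) div 9 = k" for k :: nat by presburger+
  with Mu show ?case by (subst prog_of.simps) (simp add: Let_def)
qed (subst prog_of.simps, simp)+

definition Phi :: "nat \<Rightarrow> (baire \<rightharpoonup> baire)" where
  "Phi e = functional (prog_of e)"

lemma partial_computable_iff_Phi: "partial_computable F \<longleftrightarrow> (\<exists>e. F = Phi e)"
  unfolding partial_computable_def Phi_def by (metis prog_of_prog_code)


section \<open>Codings of products\<close>

text \<open>\<open>(p, q) \<mapsto> p(0), q(0), p(1), q(1), \<dots>\<close>\<close>

definition bpair :: "baire \<Rightarrow> baire \<Rightarrow> baire" where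
  "bpair p q n = (if even n then p (n div 2) else q (n div 2))"

text \<open>\<open>(e, i, p) \<mapsto> e, i, p(0), p(1), \<dots>\<close>\<close>

definition btriple :: "nat \<times> nat \<times> baire \<Rightarrow> baire" where
  "btriple = (\<lambda>(e, i, p). case_nat e (case_nat i p))"

lemma bij_bpair: "bij (\<lambda>(p, q). bpair p q)"
proof (rule bij_betw_byWitness[where f' = "\<lambda>x. (\<lambda>n. x (2 * n), \<lambda>n. x (2 * n + 1))"])
  show "\<forall>x\<in>UNIV. (case (\<lambda>n. x (2 * n), \<lambda>n. x (2 * n + 1)) of (p, q) \<Rightarrow> bpair p q) = x"
    by (auto simp: bpair_def fun_eq_iff)
qed (auto simp: bpair_def)

lemma bij_btriple: "bij btriple"
  by (rule bij_betw_byWitness[where f' = "\<lambda>x. (x 0, x 1, \<lambda>n. x (n + 2))"])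
    (auto simp: btriple_def fun_eq_iff split: nat.splits)


section \<open>Problems and Weihrauch reducibility\<close>

text \<open>A partial multi-valued function is a set-valued function, with value \<open>{}\<close> outside its
  domain.\<close>

type_synonym problem = "baire \<Rightarrow> baire set"

definition pdom :: "problem \<Rightarrow> baire set" where
  "pdom f = {p. f p \<noteq> {}}"

definition wle :: "problem \<Rightarrow> problem \<Rightarrow> bool" (infix "\<le>\<^sub>W" 50) where
  "f \<le>\<^sub>W g \<longleftrightarrow>
     (\<exists>F G. partial_computable F \<and> partial_computable G \<and>
        (\<forall>p\<in>pdom f. \<exists>r. F p = Some r \<and> r \<in> pdom g \<and>
           (\<forall>q\<in>g r. \<exists>s. G (bpair p q) = Some s \<and> s \<in> f p)))"

definition weq :: "problem \<Rightarrow> problem \<Rightarrow> bool" (infix "\<equiv>\<^sub>W" 50) where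
  "f \<equiv>\<^sub>W g \<longleftrightarrow> f \<le>\<^sub>W g \<and> g \<le>\<^sub>W f"


section \<open>The tot-jump\<close>

definition tJ_at :: "problem \<Rightarrow> nat \<times> nat \<times> baire \<Rightarrow> baire set" where
  "tJ_at f = (\<lambda>(e, i, p).
     case Phi e p of
       None \<Rightarrow> UNIV
     | Some r \<Rightarrow>
         if r \<in> pdom f \<and> (\<forall>q\<in>f r. Phi i (bpair p q) \<noteq> None)
         then {s. \<exists>q\<in>f r. Phi i (bpair p q) = Some s}
         else UNIV)"

definition tJ :: "problem \<Rightarrow> problem" where
  "tJ f x = tJ_at f (inv btriple x)"


section \<open>Weihrauch degrees\<close>

text \<open>Transitivity of the reducibility needs that partial computable functionals compose and can be
  combined into pairs.\<close>

primrec subst_oracle :: "prog \<Rightarrow> prog \<Rightarrow> prog" where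
  "subst_oracle a Zero = Zero"
| "subst_oracle a Succ = Succ"
| "subst_oracle a Fst = Fst"
| "subst_oracle a Snd = Snd"
| "subst_oracle a Oracle = a"
| "subst_oracle a (Pair c d) = Pair (subst_oracle a c) (subst_oracle a d)"
| "subst_oracle a (Comp c d) = Comp (subst_oracle a c) (subst_oracle a d)"
| "subst_oracle a (Rec c d) = Rec (subst_oracle a c) (subst_oracle a d)"
| "subst_oracle a (Mu c) = Mu (subst_oracle a c)"

lemma functional_Some_iff: "functional c p = Some q \<longleftrightarrow> (\<forall>n. run p c n = Some (q n))"
proof
  assume "functional c p = Some q"
  then show "\<forall>n. run p c n = Some (q n)"
    unfolding functional_def by (auto split: if_splits)
qed (simp add: functional_def)

lemma run_subst_oracle:
  assumes "functional a p = Some q"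
  shows "run p (subst_oracle a c) = run q c"
proof (induction c)
  case Oracle
  then show ?case using assms by (auto simp: functional_Some_iff)
qed (rule ext, simp)+

lemma functional_subst_oracle:
  "functional a p = Some q \<Longrightarrow> functional (subst_oracle a c) p = functional c q"
  by (simp add: functional_def run_subst_oracle)

definition prog_id :: prog where "prog_id = Pair Fst Snd"

definition prog_dbl :: prog where
  "prog_dbl = Comp (Rec Zero (Comp Succ (Comp Succ (Comp Snd Snd)))) (Pair Zero prog_id)"

definition prog_step :: prog where
  "prog_step = Rec (Pair prog_id (Comp Succ Zero)) (Comp (Pair Succ Zero) Fst)"

definition prog_divmod2 :: prog where
  "prog_divmod2 = Comp (Rec (Pair Zero Zero) (Comp prog_step (Comp Snd Snd))) (Pair Zero prog_id)"

definition prog_bpair :: "prog \<Rightarrow> prog \<Rightarrow> prog" where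
  "prog_bpair a b = Comp (Rec a (Comp b Fst)) prog_divmod2"

lemma run_id: "run p prog_id x = Some x"
  by (simp add: prog_id_def)

lemma run_dbl: "run p prog_dbl x = Some (2 * x)"
proof -
  have "rec_nat (Some 0) (\<lambda>m r. Option.bind r (\<lambda>v. Some (Suc (Suc v)))) n = Some (2 * n)" for n
    by (induction n) auto
  then show ?thesis by (simp add: prog_dbl_def run_id)
qed

lemma run_step:
  "run p prog_step (prod_encode (h, b)) =
     (if b = 0 then Some (prod_encode (h, 1)) else Some (prod_encode (Suc h, 0)))"
proof -
  have "rec_nat u (\<lambda>m r. Option.bind r (\<lambda>v. Some w)) (Suc b) = Some w" if "u \<noteq> None" for u b and w :: nat
    using that by (induction b) auto
  then show ?thesis by (cases b) (auto simp: prog_step_def run_id simp del: old.nat.rec(2))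
qed

lemma run_divmod2: "run p prog_divmod2 x = Some (prod_encode (x div 2, x mod 2))"
proof -
  have "rec_nat (Some (prod_encode (0, 0))) (\<lambda>m r. Option.bind r (run p prog_step)) n =
      Some (prod_encode (n div 2, n mod 2))" for n
  proof (induction n)
    case (Suc n)
    show ?case
    proof (cases "even n")
      case True
      then have "n mod 2 = 0" "Suc n mod 2 = 1" "Suc n div 2 = n div 2" by presburger+
      then show ?thesis using Suc by (simp add: run_step)
    next
      case False
      then have "n mod 2 = 1" "Suc n mod 2 = 0" "Suc n div 2 = Suc (n div 2)" by presburger+
      then show ?thesis using Suc by (simp add: run_step)
    qed
  qed simp
  then show ?thesis by (simp add: prog_divmod2_def run_id)
qed

lemma functional_bpair:
  assumes "functional a t = Some p" "functional b t = Some q"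
  shows "functional (prog_bpair a b) t = Some (bpair p q)"
proof -
  have "run t (prog_bpair a b) n = Some (bpair p q n)" for n
    using assms
    by (cases "even n")
      (auto simp: functional_Some_iff prog_bpair_def run_divmod2 bpair_def odd_iff_mod_2_eq_one)
  then show ?thesis by (simp add: functional_Some_iff)
qed

lemma functional_left: "functional (Comp Oracle prog_dbl) (bpair p q) = Some p"
  by (simp add: functional_Some_iff run_dbl bpair_def)

lemma functional_right: "functional (Comp Oracle (Comp Succ prog_dbl)) (bpair p q) = Some q"
  by (simp add: functional_Some_iff run_dbl bpair_def)

lemma wle_refl: "f \<le>\<^sub>W f"
  unfolding wle_def partial_computable_def
proof (intro exI conjI ballI)
  show "functional Oracle p = Some p" for p by (simp add: functional_Some_iff)
qed (use functional_right in auto)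

lemma wle_trans:
  assumes "f \<le>\<^sub>W g" "g \<le>\<^sub>W h"
  shows "f \<le>\<^sub>W h"
proof -
  obtain a b where ab: "\<And>p. p \<in> pdom f \<Longrightarrow> \<exists>r. functional a p = Some r \<and> r \<in> pdom g \<and>
      (\<forall>q\<in>g r. \<exists>s. functional b (bpair p q) = Some s \<and> s \<in> f p)"
    using assms(1) unfolding wle_def partial_computable_def by blast
  obtain c d where cd: "\<And>p. p \<in> pdom g \<Longrightarrow> \<exists>r. functional c p = Some r \<and> r \<in> pdom h \<and>
      (\<forall>q\<in>h r. \<exists>s. functional d (bpair p q) = Some s \<and> s \<in> g p)"
    using assms(2) unfolding wle_def partial_computable_def by blast
  define left where "left = Comp Oracle prog_dbl"
  define right where "right = Comp Oracle (Comp Succ prog_dbl)"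
  define A where "A = subst_oracle a c"
  define B where
    "B = subst_oracle
           (prog_bpair left (subst_oracle (prog_bpair (subst_oracle left a) right) d)) b"
  have "\<exists>r. functional A p = Some r \<and> r \<in> pdom h \<and>
      (\<forall>q\<in>h r. \<exists>s. functional B (bpair p q) = Some s \<and> s \<in> f p)" if p: "p \<in> pdom f" for p
  proof -
    obtain u where u: "functional a p = Some u" "u \<in> pdom g"
      and b: "\<And>q. q \<in> g u \<Longrightarrow> \<exists>s. functional b (bpair p q) = Some s \<and> s \<in> f p"
      using ab[OF p] by blast
    obtain r where r: "functional c u = Some r" "r \<in> pdom h"
      and d: "\<And>q. q \<in> h r \<Longrightarrow> \<exists>s. functional d (bpair u q) = Some s \<and> s \<in> g u"
      using cd[OF u(2)] by blast
    have "\<exists>s. functional B (bpair p q) = Some s \<and> s \<in> f p" if q: "q \<in> h r" for q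
    proof -
      obtain v where v: "functional d (bpair u q) = Some v" "v \<in> g u" using d[OF q] by blast
      have l: "functional left (bpair p q) = Some p" and r: "functional right (bpair p q) = Some q"
        by (simp_all only: left_def right_def functional_left functional_right)
      have "functional (subst_oracle left a) (bpair p q) = Some u"
        using functional_subst_oracle[OF l] u by simp
      from functional_subst_oracle[OF functional_bpair[OF this r]] v
      have "functional (subst_oracle (prog_bpair (subst_oracle left a) right) d) (bpair p q) = Some v"
        by simp
      from functional_subst_oracle[OF functional_bpair[OF l this]]
      show ?thesis using b[OF v(2)] by (simp add: B_def)
    qed
    then show ?thesis using r functional_subst_oracle[OF u(1)] by (auto simp: A_def)
  qed
  then show ?thesis unfolding wle_def partial_computable_def by blast
qed

quotient_type wdegree = problem / weq
  by (rule equivpI) (auto simp: reflp_def symp_def transp_def weq_def intro: wle_refl wle_trans)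

instantiation wdegree :: order
begin

lift_definition less_eq_wdegree :: "wdegree \<Rightarrow> wdegree \<Rightarrow> bool" is wle
  by (auto simp: weq_def intro: wle_trans)

definition less_wdegree :: "wdegree \<Rightarrow> wdegree \<Rightarrow> bool" where
  "less_wdegree a b \<longleftrightarrow> a \<le> b \<and> \<not> b \<le> a"

instance
proof
  fix a b c :: wdegree
  show "a < b \<longleftrightarrow> a \<le> b \<and> \<not> b \<le> a" by (rule less_wdegree_def)
  show "a \<le> a" by transfer (rule wle_refl)
  show "a \<le> b \<Longrightarrow> b \<le> c \<Longrightarrow> a \<le> c" by transfer (rule wle_trans)
  show "a \<le> b \<Longrightarrow> b \<le> a \<Longrightarrow> a = b" by transfer (simp add: weq_def)
qed

end

lift_definition wdeg :: "problem \<Rightarrow> wdegree" is "\<lambda>f. f" .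

lemma wdeg_eq_iff: "wdeg f = wdeg g \<longleftrightarrow> f \<equiv>\<^sub>W g"
  by transfer simp

lemma wdeg_le_iff: "wdeg f \<le> wdeg g \<longleftrightarrow> f \<le>\<^sub>W g"
  by transfer simp

lemma surj_wdeg: "surj wdeg"
proof (rule surjI)
  show "wdeg (rep_wdegree a) = a" for a
    by (metis Quotient3_abs_rep Quotient3_wdegree wdeg.abs_eq)
qed

end

theory Submission imports Defs
begin

text \<open>
  The first part is a diagonalization. Let \<open>F\<close> and \<open>G\<close> reduce \<open>tJ f\<close> to \<open>tJ g\<close>, and let \<open>p\<close> be in the
  domain of \<open>f\<close>. The jump \<open>tJ f\<close> is asked a question \<open>x = (e, i, u)\<close>, where \<open>u\<close> is \<open>p\<close> with \<open>i\<close>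
  put in front and \<open>e\<close> is the code of a program that drops the first entry, so that \<open>\<Phi>\<^sub>e(u) = p\<close>. The input
  \<open>(u, q)\<close> of \<open>\<Phi>\<^sub>i\<close> contains \<open>i\<close>, and so \<open>\<Phi>\<^sub>i\<close> can compute \<open>x\<close>; this takes the place of the recursion
  theorem. It searches through a dense sequence of points \<open>t\<close> for one where
  \<open>G(x, t)(0)\<close> halts, and for the first value \<open>y\<close> it finds, it outputs the sequence of the codes of the
  pairs \<open>(y + 1, q(n))\<close>. The search succeeds: \<open>tJ g\<close> is total, so \<open>G(x, q')\<close> is defined for some \<open>q'\<close>, and
  by continuity its entry at \<open>0\<close> is already determined by a finite part of \<open>q'\<close>. Hence the answers
  to \<open>x\<close> are exactly the outputs of \<open>\<Phi>\<^sub>i\<close>, and their entry at \<open>0\<close> exceeds \<open>y\<close>. If \<open>F(x)\<close> were a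
  question \<open>(e', i', p')\<close> at which \<open>tJ g\<close> allows every answer, then the point \<open>t\<close> found would be an answer
  and \<open>G(x, t)\<close>, whose entry at \<open>0\<close> is \<open>y\<close>, would have to be an answer to \<open>x\<close>, a contradiction. Therefore
  \<open>\<Phi>\<^sub>e\<^sub>'(p')\<close> is in the domain of \<open>g\<close>, and each \<open>q\<close> that \<open>g\<close> returns there gives the answer \<open>\<Phi>\<^sub>i\<^sub>'(p', q)\<close> to
  \<open>F(x)\<close>, which \<open>G\<close> turns into an answer to \<open>x\<close>, and the second components of that form an element of
  \<open>f(p)\<close>. This is \<open>tJ_reflects_wle\<close>. The converse implication \<open>tJ_mono\<close> passes the whole question on to
  \<open>tJ g\<close>, with fixed indices whose programs interpret the original ones. Together they say that \<open>tJ\<close> is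
  an order embedding of the Weihrauch degrees.

  Both directions run a program whose code is only known from the input, so a universal functional
  is needed. It comes from a stack machine on natural numbers whose step function is computable. The
  machine only has to simulate computations that halt (\<open>reaches_run\<close>): as it is deterministic, a value
  that it returns can only be the right one whenever there is a right one. One search over oracles
  and numbers of steps (\<open>dovetailed_search\<close>) yields both the universal functional and the
  diagonalizing program.
\<close>

section \<open>Uniformly computable total functions\<close>

text \<open>One program must work for all oracles. The functions are total, so computability of a composite
  expression follows from its syntax, without side conditions on halting.\<close>

definition uniformly_computable :: "(baire \<Rightarrow> nat \<Rightarrow> nat) \<Rightarrow> bool" where
  "uniformly_computable H \<longleftrightarrow> (\<exists>c. \<forall>z x. run z c x = Some (H z x))"

lemma uc_comp:
  assumes "uniformly_computable H" "uniformly_computable A"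
  shows "uniformly_computable (\<lambda>z w. H z (A z w))"
proof -
  from assms obtain h a where "\<And>z x. run z h x = Some (H z x)" "\<And>z x. run z a x = Some (A z x)"
    unfolding uniformly_computable_def by metis
  then have "run z (Comp h a) x = Some (H z (A z x))" for z x by simp
  then show ?thesis unfolding uniformly_computable_def by blast
qed

lemma uc_prod_encode:
  assumes "uniformly_computable A" "uniformly_computable B"
  shows "uniformly_computable (\<lambda>z w. prod_encode (A z w, B z w))"
proof -
  from assms obtain a b where "\<And>z x. run z a x = Some (A z x)" "\<And>z x. run z b x = Some (B z x)"
    unfolding uniformly_computable_def by metis
  then have "run z (Pair a b) x = Some (prod_encode (A z x, B z x))" for z x by simp
  then show ?thesis unfolding uniformly_computable_def by blast
qed

lemma uc_arg: "uniformly_computable (\<lambda>z w. w)"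
  unfolding uniformly_computable_def using run_id by blast

lemma uc_Suc:
  assumes "uniformly_computable A"
  shows "uniformly_computable (\<lambda>z w. Suc (A z w))"
proof -
  have "uniformly_computable (\<lambda>z w. Suc w)"
    unfolding uniformly_computable_def by (rule exI[of _ Succ]) simp
  from uc_comp[OF this assms] show ?thesis .
qed

lemma uc_fst:
  assumes "uniformly_computable A"
  shows "uniformly_computable (\<lambda>z w. fst (prod_decode (A z w)))"
proof -
  have "uniformly_computable (\<lambda>z w. fst (prod_decode w))"
    unfolding uniformly_computable_def by (rule exI[of _ Fst]) simp
  from uc_comp[OF this assms] show ?thesis .
qed

lemma uc_snd:
  assumes "uniformly_computable A"
  shows "uniformly_computable (\<lambda>z w. snd (prod_decode (A z w)))"
proof -
  have "uniformly_computable (\<lambda>z w. snd (prod_decode w))"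
    unfolding uniformly_computable_def by (rule exI[of _ Snd]) simp
  from uc_comp[OF this assms] show ?thesis .
qed

lemma uc_oracle:
  assumes "uniformly_computable A"
  shows "uniformly_computable (\<lambda>z w. z (A z w))"
proof -
  have "uniformly_computable (\<lambda>z w. z w)"
    unfolding uniformly_computable_def by (rule exI[of _ Oracle]) simp
  from uc_comp[OF this assms] show ?thesis .
qed

lemma uc_const: "uniformly_computable (\<lambda>z w. k)"
proof (induction k)
  case 0
  show ?case unfolding uniformly_computable_def by (rule exI[of _ Zero]) simp
qed (rule uc_Suc)

text \<open>The second assumption is computability of the step function in its three number arguments, coded
  in the way in which \<open>Rec\<close> passes them.\<close>

lemma uc_rec_nat:
  assumes "uniformly_computable A"
    and "uniformly_computable (\<lambda>z u. B z (fst (prod_decode u))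
          (fst (prod_decode (snd (prod_decode u)))) (snd (prod_decode (snd (prod_decode u)))))"
    and "uniformly_computable N"
  shows "uniformly_computable (\<lambda>z w. rec_nat (A z w) (\<lambda>m r. B z w m r) (N z w))"
proof -
  obtain a where a: "\<And>z x. run z a x = Some (A z x)"
    using assms(1) unfolding uniformly_computable_def by metis
  obtain b where b: "\<And>z x. run z b x = Some (B z (fst (prod_decode x))
          (fst (prod_decode (snd (prod_decode x)))) (snd (prod_decode (snd (prod_decode x)))))"
    using assms(2) unfolding uniformly_computable_def by metis
  obtain n where n: "\<And>z x. run z n x = Some (N z x)"
    using assms(3) unfolding uniformly_computable_def by metis
  have "rec_nat (Some (A z w)) (\<lambda>m r. Option.bind r (\<lambda>v. Some (B z w m v))) k =
      Some (rec_nat (A z w) (\<lambda>m r. B z w m r) k)" for z w k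
    by (induction k) auto
  then have "run z (Comp (Rec a b) (Pair prog_id n)) w =
      Some (rec_nat (A z w) (\<lambda>m r. B z w m r) (N z w))" for z w
    by (simp add: a b n run_id)
  then show ?thesis unfolding uniformly_computable_def by blast
qed

lemma uc_if_0:
  assumes "uniformly_computable C" "uniformly_computable A" "uniformly_computable B"
  shows "uniformly_computable (\<lambda>z w. if C z w = 0 then A z w else B z w)"
proof -
  have "uniformly_computable (\<lambda>z w. rec_nat (A z w) (\<lambda>m r. B z w) (C z w))"
    by (intro uc_rec_nat assms uc_comp[OF assms(3)] uc_fst uc_arg)
  moreover have "rec_nat (A z w) (\<lambda>m r. B z w) (C z w) = (if C z w = 0 then A z w else B z w)"
    for z w by (cases "C z w") auto
  ultimately show ?thesis by simp
qed

lemma uc_pred: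
  assumes "uniformly_computable A"
  shows "uniformly_computable (\<lambda>z w. A z w - Suc 0)"
proof -
  have "uniformly_computable (\<lambda>z w. rec_nat 0 (\<lambda>m r. m) (A z w))"
    by (intro uc_rec_nat assms uc_const uc_fst uc_snd uc_arg)
  moreover have "rec_nat 0 (\<lambda>m r. m) k = k - Suc 0" for k :: nat
    by (cases k) auto
  ultimately show ?thesis by simp
qed

lemma uc_if_eq:
  assumes "uniformly_computable C" "uniformly_computable A" "uniformly_computable B"
  shows "uniformly_computable (\<lambda>z w. if C z w = k then A z w else B z w)"
  using assms(1)
proof (induction k arbitrary: C)
  case 0
  then show ?case by (rule uc_if_0[OF _ assms(2,3)])
next
  case (Suc k)
  have "uniformly_computable (\<lambda>z w. if C z w = 0 then B z w else
      if C z w - Suc 0 = k then A z w else B z w)"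
    by (intro uc_if_0 Suc assms uc_pred)
  moreover have "(if C z w = 0 then B z w else if C z w - Suc 0 = k then A z w else B z w) =
      (if C z w = Suc k then A z w else B z w)" for z w by (cases "C z w") auto
  ultimately show ?case by simp
qed

lemma uc_mod:
  assumes "uniformly_computable A" "0 < k"
  shows "uniformly_computable (\<lambda>z w. A z w mod k)"
proof -
  have "uniformly_computable (\<lambda>z w. rec_nat 0 (\<lambda>m r. if Suc r = k then 0 else Suc r) (A z w))"
    by (intro uc_rec_nat uc_if_eq assms uc_const uc_Suc uc_snd uc_arg)
  moreover have "rec_nat 0 (\<lambda>m r. if Suc r = k then 0 else Suc r) n = n mod k" for n
    using assms(2) by (induction n) (auto simp: mod_Suc)
  ultimately show ?thesis by simp
qed

lemma uc_div:
  assumes "uniformly_computable A" "0 < k"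
  shows "uniformly_computable (\<lambda>z w. A z w div k)"
proof -
  have "uniformly_computable
      (\<lambda>z w. rec_nat 0 (\<lambda>m r. if Suc m mod k = 0 then Suc r else r) (A z w))"
    by (intro uc_rec_nat uc_if_eq uc_mod assms uc_const uc_Suc uc_snd uc_fst uc_arg)
  moreover have "rec_nat 0 (\<lambda>m r. if Suc m mod k = 0 then Suc r else r) n = n div k" for n
    using assms(2) by (induction n) (auto simp: div_Suc)
  ultimately show ?thesis by simp
qed

lemma uc_case_nat:
  assumes "uniformly_computable A"
    and "uniformly_computable (\<lambda>z u. B z (fst (prod_decode u)) (snd (prod_decode u)))"
    and "uniformly_computable N"
  shows "uniformly_computable (\<lambda>z w. case_nat (A z w) (\<lambda>m. B z w m) (N z w))"
proof -
  have "uniformly_computable (\<lambda>z w. if N z w = 0 then A z w else B z w (N z w - Suc 0))"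
    using uc_comp[OF assms(2) uc_prod_encode[OF uc_arg uc_pred[OF assms(3)]]]
    by (intro uc_if_0 assms) simp
  moreover have "(if N z w = 0 then A z w else B z w (N z w - Suc 0)) =
      case_nat (A z w) (\<lambda>m. B z w m) (N z w)" for z w by (cases "N z w") auto
  ultimately show ?thesis by simp
qed

lemma uc_bpair:
  assumes "uniformly_computable (\<lambda>z u. P z (fst (prod_decode u)) (snd (prod_decode u)))"
    and "uniformly_computable (\<lambda>z u. Q z (fst (prod_decode u)) (snd (prod_decode u)))"
    and "uniformly_computable N"
  shows "uniformly_computable (\<lambda>z w. bpair (P z w) (Q z w) (N z w))"
proof -
  have "uniformly_computable (\<lambda>z w. N z w div 2)"
    by (intro uc_div assms) simp
  from uc_comp[OF assms(1) uc_prod_encode[OF uc_arg this]]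
    uc_comp[OF assms(2) uc_prod_encode[OF uc_arg this]]
  have "uniformly_computable (\<lambda>z w. if N z w mod 2 = 0 then P z w (N z w div 2)
      else Q z w (N z w div 2))"
    by (intro uc_if_eq uc_mod assms) simp_all
  then show ?thesis by (simp add: bpair_def even_iff_mod_2_eq_zero)
qed

lemma uc_funpow:
  assumes "uniformly_computable (\<lambda>z u. f z (fst (prod_decode u)) (snd (prod_decode u)))"
    and "uniformly_computable X" "uniformly_computable N"
  shows "uniformly_computable (\<lambda>z w. (f z w ^^ N z w) (X z w))"
proof -
  have "uniformly_computable (\<lambda>z u. f z (fst (prod_decode u)) (snd (prod_decode (snd (prod_decode u)))))"
    using uc_comp[OF assms(1) uc_prod_encode[OF uc_fst[OF uc_arg] uc_snd[OF uc_snd[OF uc_arg]]]]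
    by simp
  from uc_rec_nat[OF assms(2) this assms(3)]
  have "uniformly_computable (\<lambda>z w. rec_nat (X z w) (\<lambda>m. f z w) (N z w))" .
  moreover have "rec_nat x (\<lambda>m. h) n = (h ^^ n) x" for x n and h :: "nat \<Rightarrow> nat"
    by (induction n) auto
  ultimately show ?thesis by simp
qed

lemma uc_double:
  assumes "uniformly_computable A"
  shows "uniformly_computable (\<lambda>z w. 2 * A z w)"
proof -
  have "uniformly_computable (\<lambda>z w. 2 * w)"
    unfolding uniformly_computable_def using run_dbl by blast
  from uc_comp[OF this assms] show ?thesis .
qed

lemmas uc_basic = uc_if_eq uc_case_nat uc_bpair uc_mod uc_div uc_pred uc_prod_encode
  uc_Suc uc_fst uc_snd uc_oracle uc_const uc_arg

lemma uc_functional: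
  assumes "uniformly_computable H"
  shows "\<exists>c. \<forall>z. functional c z = Some (H z)"
  using assms unfolding uniformly_computable_def functional_Some_iff by blast


section \<open>A universal stack machine\<close>

text \<open>A state is a pair of a stack and a current value, and a stack is a number, \<open>0\<close> being the empty one. A
  frame \<open>(g, d)\<close> is an instruction of kind \<open>g\<close> that acts on the current value \<open>x\<close>. Kind \<open>0\<close> runs the program
  with code \<open>d\<close> on \<open>x\<close>. Kind \<open>1\<close> replaces \<open>x\<close> by the pair \<open>(d, x)\<close>. Kind \<open>2\<close> expects a pair \<open>(y, v)\<close>, runs \<open>d\<close>
  on \<open>y\<close> and pairs \<open>v\<close> with the result. Kind \<open>3\<close> expects \<open>(y, n)\<close> and searches from \<open>n\<close> upwards for a
  zero of \<open>d(y, \<cdot>)\<close>. Kind \<open>4\<close> receives \<open>((y, n), v)\<close> with \<open>v = d(y, n)\<close> and stops or continues this search.\<close>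

definition push :: "nat \<Rightarrow> nat \<Rightarrow> nat \<Rightarrow> nat" where
  "push g d K = Suc (prod_encode (prod_encode (g, d), K))"

text \<open>The case distinction follows the Goedel numbering. For \<open>Rec\<close> at a successor, the code \<open>e\<close> itself is
  pushed again, with smaller argument, above frames that rebuild the argument of \<open>d\<close>.\<close>

definition step_prog :: "baire \<Rightarrow> nat \<Rightarrow> nat \<Rightarrow> nat \<Rightarrow> nat" where
  "step_prog p e K x =
     (let t = e mod 9; k = e div 9; c = fst (prod_decode k); d = snd (prod_decode k);
          a = fst (prod_decode x); m = snd (prod_decode x) in
      if t = 0 then prod_encode (K, 0)
      else if t = 1 then prod_encode (K, Suc x)
      else if t = 2 then prod_encode (K, a)
      else if t = 3 then prod_encode (K, m)
      else if t = 4 then prod_encode (K, p x)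
      else if t = 5 then prod_encode (push 0 c (push 1 x (push 2 d K)), x)
      else if t = 6 then prod_encode (push 0 d (push 0 c K), x)
      else if t = 7 then
        (if m = 0 then prod_encode (push 0 c K, a)
         else prod_encode (push 0 e (push 1 (m - Suc 0) (push 1 a (push 0 d K))),
                prod_encode (a, m - Suc 0)))
      else prod_encode (push 3 k K, prod_encode (x, 0)))"

definition step_frame :: "baire \<Rightarrow> nat \<Rightarrow> nat \<Rightarrow> nat \<Rightarrow> nat \<Rightarrow> nat" where
  "step_frame p g d K x =
     (let y = fst (prod_decode x); v = snd (prod_decode x) in
      if g = 0 then step_prog p d K x
      else if g = 1 then prod_encode (K, prod_encode (d, x))
      else if g = 2 then prod_encode (push 0 d (push 1 v K), y)
      else if g = 3 then prod_encode (push 0 d (push 1 x (push 4 d K)), x)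
      else if v = 0 then prod_encode (K, snd (prod_decode y))
      else prod_encode (push 3 d K,
             prod_encode (fst (prod_decode y), Suc (snd (prod_decode y)))))"

definition step :: "baire \<Rightarrow> nat \<Rightarrow> nat" where
  "step p w =
     (let S = fst (prod_decode w); x = snd (prod_decode w);
          f = fst (prod_decode (S - Suc 0)); K = snd (prod_decode (S - Suc 0)) in
      if S = 0 then w else step_frame p (fst (prod_decode f)) (snd (prod_decode f)) K x)"

definition reaches :: "baire \<Rightarrow> nat \<Rightarrow> nat \<Rightarrow> nat \<Rightarrow> nat \<Rightarrow> bool" where
  "reaches p S x K v \<longleftrightarrow> (\<exists>n. (step p ^^ n) (prod_encode (S, x)) = prod_encode (K, v))"

lemma step_push: "step p (prod_encode (push g d K, x)) = step_frame p g d K x"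
  by (simp add: step_def push_def)

lemma reaches_refl: "reaches p S x S x"
  unfolding reaches_def by (rule exI[of _ 0]) simp

lemma reaches_trans:
  assumes "reaches p S x T y" "reaches p T y K v"
  shows "reaches p S x K v"
proof -
  obtain m n where "(step p ^^ m) (prod_encode (S, x)) = prod_encode (T, y)"
    and "(step p ^^ n) (prod_encode (T, y)) = prod_encode (K, v)"
    using assms unfolding reaches_def by blast
  then have "(step p ^^ (n + m)) (prod_encode (S, x)) = prod_encode (K, v)"
    by (simp add: funpow_add)
  then show ?thesis unfolding reaches_def by blast
qed

lemma reaches_step:
  assumes "step_frame p g d L x = prod_encode (T, y)" "reaches p T y K v"
  shows "reaches p (push g d L) x K v"
proof (rule reaches_trans[OF _ assms(2)])
  have "(step p ^^ 1) (prod_encode (push g d L, x)) = prod_encode (T, y)"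
    using assms(1) by (simp add: step_push)
  then show "reaches p (push g d L) x T y" unfolding reaches_def by blast
qed

lemma reaches_Left: "reaches p K (prod_encode (d, x)) L v \<Longrightarrow> reaches p (push 1 d K) x L v"
  by (rule reaches_step) (simp_all add: step_frame_def)

text \<open>The stack below the program is arbitrary, so that the statement can be used for subprograms while
  other frames are waiting. The induction is on codes and not on programs, since \<open>prog_of\<close> is not injective.\<close>

lemma reaches_run:
  assumes "run p (prog_of e) x = Some v"
  shows "reaches p (push 0 e K) x K v"
  using assms
proof (induction e arbitrary: x v K rule: less_induct)
  case (less e)
  define k where "k = e div 9"
  define c where "c = fst (prod_decode k)"
  define d where "d = snd (prod_decode k)"
  have lt: "k < e" "c < e" "d < e" if "e mod 9 \<noteq> 0"
  proof -
    show "k < e" using that unfolding k_def by (cases "e = 0") auto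
    then show "c < e" "d < e" unfolding c_def d_def using prod_decode_le le_less_trans by blast+
  qed
  have start: "reaches p (push 0 e K) x K v" if "step_prog p e K x = prod_encode (T, y)"
    "reaches p T y K v" for K x T y v
    using that by (intro reaches_step) (simp_all add: step_frame_def)
  have tags: "t = 0 \<or> t = 1 \<or> t = 2 \<or> t = 3 \<or> t = 4 \<or> t = 5 \<or> t = 6 \<or> t = 7 \<or> t = 8"
    if "t < 9" for t :: nat
    using that by presburger
  have "e mod 9 < 9" by simp
  from tags[OF this] consider "e mod 9 = 0" | "e mod 9 = 1" | "e mod 9 = 2" | "e mod 9 = 3"
    | "e mod 9 = 4" | "e mod 9 = 5" | "e mod 9 = 6" | "e mod 9 = 7" | "e mod 9 = 8"
    by metis
  then show ?case
  proof cases
    case 1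
    then have "prog_of e = Zero" by (subst prog_of.simps) simp
    with less.prems 1 show ?thesis
      by (intro start[OF _ reaches_refl]) (simp add: step_prog_def)
  next
    case 2
    then have "prog_of e = Succ" by (subst prog_of.simps) simp
    with less.prems 2 show ?thesis
      by (intro start[OF _ reaches_refl]) (simp add: step_prog_def)
  next
    case 3
    then have "prog_of e = Fst" by (subst prog_of.simps) simp
    with less.prems 3 show ?thesis
      by (intro start[OF _ reaches_refl]) (simp add: step_prog_def)
  next
    case 4
    then have "prog_of e = Snd" by (subst prog_of.simps) simp
    with less.prems 4 show ?thesis
      by (intro start[OF _ reaches_refl]) (simp add: step_prog_def)
  next
    case 5
    then have "prog_of e = Oracle" by (subst prog_of.simps) simp
    with less.prems 5 show ?thesis
      by (intro start[OF _ reaches_refl]) (simp add: step_prog_def)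
  next
    case 6
    then have e: "prog_of e = Pair (prog_of c) (prog_of d)"
      by (subst prog_of.simps) (simp add: k_def c_def d_def Let_def)
    with less.prems obtain u w where u: "run p (prog_of c) x = Some u"
      and w: "run p (prog_of d) x = Some w" and v: "v = prod_encode (u, w)"
      by (auto simp: bind_eq_Some_conv)
    have "reaches p (push 0 d (push 1 u K)) x K v"
      unfolding v using 6 lt
      by (intro reaches_trans[OF less.IH[OF _ w]] reaches_Left reaches_refl) simp
    then have "reaches p (push 2 d K) (prod_encode (x, u)) K v"
      by (rule reaches_step[rotated]) (simp add: step_frame_def)
    then have "reaches p (push 0 c (push 1 x (push 2 d K))) x K v"
      using 6 lt by (intro reaches_trans[OF less.IH[OF _ u]] reaches_Left) simp_all
    then show ?thesis
      by (rule start[rotated]) (simp add: step_prog_def 6 k_def c_def d_def Let_def)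
  next
    case 7
    then have e: "prog_of e = Comp (prog_of c) (prog_of d)"
      by (subst prog_of.simps) (simp add: k_def c_def d_def Let_def)
    with less.prems obtain u where u: "run p (prog_of d) x = Some u"
      and w: "run p (prog_of c) u = Some v"
      by (auto simp: bind_eq_Some_conv)
    have "reaches p (push 0 d (push 0 c K)) x K v"
      using 7 lt by (intro reaches_trans[OF less.IH[OF _ u] less.IH[OF _ w]]) simp_all
    then show ?thesis
      by (rule start[rotated]) (simp add: step_prog_def 7 k_def c_def d_def Let_def)
  next
    case 8
    then have e: "prog_of e = Rec (prog_of c) (prog_of d)"
      by (subst prog_of.simps) (simp add: k_def c_def d_def Let_def)
    have "reaches p (push 0 e K) (prod_encode (a, m)) K v"
      if "run p (prog_of e) (prod_encode (a, m)) = Some v" for a m v K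
      using that
    proof (induction m arbitrary: v K)
      case 0
      then have "run p (prog_of c) a = Some v" by (simp add: e)
      then have "reaches p (push 0 c K) a K v" using 8 lt by (intro less.IH) simp_all
      then show ?case
        by (rule start[rotated]) (simp add: step_prog_def 8 k_def c_def Let_def)
    next
      case (Suc m)
      then obtain u where u: "run p (prog_of e) (prod_encode (a, m)) = Some u"
        and v: "run p (prog_of d) (prod_encode (a, prod_encode (m, u))) = Some v"
        by (auto simp: e bind_eq_Some_conv)
      have "reaches p (push 0 e (push 1 m (push 1 a (push 0 d K)))) (prod_encode (a, m)) K v"
        using 8 lt by (intro reaches_trans[OF Suc.IH[OF u]] reaches_Left less.IH v) simp_all
      then show ?case
        by (rule start[rotated]) (simp add: step_prog_def 8 k_def d_def Let_def)
    qed
    from this[of "fst (prod_decode x)" "snd (prod_decode x)"] less.prems show ?thesis by simp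
  next
    case 9
    then have e: "prog_of e = Mu (prog_of k)"
      by (subst prog_of.simps) (simp add: k_def Let_def)
    let ?found = "\<lambda>n. run p (prog_of k) (prod_encode (x, n)) = Some 0 \<and>
      (\<forall>m<n. \<exists>v. run p (prog_of k) (prod_encode (x, m)) = Some (Suc v))"
    have ex: "\<exists>n. ?found n" and v: "v = (LEAST n. ?found n)"
      using less.prems by (auto simp: e Let_def split: if_splits)
    have "?found v" unfolding v using ex by (rule LeastI_ex)
    then have hit: "run p (prog_of k) (prod_encode (x, v)) = Some 0"
      and miss: "\<And>m. m < v \<Longrightarrow> \<exists>u. run p (prog_of k) (prod_encode (x, m)) = Some (Suc u)"
      by auto
    have miss_or_hit: "reaches p (push 3 k K) (prod_encode (x, n)) K v"
      if "run p (prog_of k) (prod_encode (x, n)) = Some u"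
        and "reaches p (push 4 k K) (prod_encode (prod_encode (x, n), u)) K v" for n u
    proof -
      have "reaches p (push 0 k (push 1 (prod_encode (x, n)) (push 4 k K))) (prod_encode (x, n)) K v"
        using 9 lt that by (intro reaches_trans[OF less.IH] reaches_Left) simp_all
      then show ?thesis by (rule reaches_step[rotated]) (simp add: step_frame_def)
    qed
    have "reaches p (push 3 k K) (prod_encode (x, 0)) K v"
    proof (rule inc_induct[OF le0[of v]])
      show "reaches p (push 3 k K) (prod_encode (x, v)) K v"
      proof (rule miss_or_hit[OF hit], rule reaches_step[OF _ reaches_refl])
        show "step_frame p 4 k K (prod_encode (prod_encode (x, v), 0)) = prod_encode (K, v)"
          by (simp add: step_frame_def)
      qed
    next
      fix n
      assume "n < v" and IH: "reaches p (push 3 k K) (prod_encode (x, Suc n)) K v"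
      then obtain u where u: "run p (prog_of k) (prod_encode (x, n)) = Some (Suc u)"
        using miss by blast
      show "reaches p (push 3 k K) (prod_encode (x, n)) K v"
        by (rule miss_or_hit[OF u], rule reaches_step[OF _ IH]) (simp add: step_frame_def)
    qed
    then show ?thesis
      by (rule start[rotated]) (simp add: step_prog_def 9 k_def Let_def)
  qed
qed

lemma halted_stays: "(step p ^^ n) (prod_encode (0, v)) = prod_encode (0, v)"
  by (induction n) (simp_all add: step_def)

text \<open>This replaces a soundness proof of the machine: a halted state is a fixed point, and so a computed
  value agrees with that of any other halting computation from the same state.\<close>

lemma halting_value_unique:
  assumes "reaches p S x 0 u" "reaches p S x 0 v"
  shows "u = v"
proof -
  obtain m n where m: "(step p ^^ m) (prod_encode (S, x)) = prod_encode (0, u)"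
    and n: "(step p ^^ n) (prod_encode (S, x)) = prod_encode (0, v)"
    using assms unfolding reaches_def by blast
  have "(step p ^^ (n + m)) (prod_encode (S, x)) = prod_encode (0, u)"
    by (simp add: funpow_add m halted_stays)
  moreover have "(step p ^^ (m + n)) (prod_encode (S, x)) = prod_encode (0, v)"
    by (simp add: funpow_add n halted_stays)
  ultimately show ?thesis by (simp add: add.commute)
qed

text \<open>The oracle of the machine is allowed to vary with a parameter, as the diagonalization tries many
  oracles.\<close>

lemma uc_step:
  assumes answers: "\<And>A B. uniformly_computable A \<Longrightarrow> uniformly_computable B \<Longrightarrow>
      uniformly_computable (\<lambda>z w. Q z (A z w) (B z w))"
    and "uniformly_computable T" "uniformly_computable W"
  shows "uniformly_computable (\<lambda>z w. step (Q z (T z w)) (W z w))"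
  unfolding step_def step_frame_def step_prog_def push_def Let_def
  by (intro uc_basic answers assms(2,3)) simp_all


text \<open>Unbounded search through the pairs of a parameter \<open>t\<close> and a number of steps finds a halting run of the
  machine, since one exists where the program halts. The conclusion about the value is conditional
  because \<open>halting_value_unique\<close> compares it with that of a halting computation of the program.\<close>

lemma dovetailed_search:
  assumes answers: "\<And>A B. uniformly_computable A \<Longrightarrow> uniformly_computable B \<Longrightarrow>
      uniformly_computable (\<lambda>z w. Q z (A z w) (B z w))"
    and E: "uniformly_computable (\<lambda>z w. E z)"
  obtains c where "\<And>z x t v. run (Q z t) (prog_of (E z)) x = Some v \<Longrightarrow>
      \<exists>t v. run z c x = Some v \<and> (\<forall>u. run (Q z t) (prog_of (E z)) x = Some u \<longrightarrow> u = v)"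
proof -
  \<comment> \<open>\<open>w\<close> codes \<open>(x, t, s)\<close>, and \<open>S z w\<close> is the state after \<open>s\<close> steps on input \<open>x\<close> with oracle \<open>Q z t\<close>.\<close>
  define S where "S z w = (step (Q z (fst (prod_decode (snd (prod_decode w)))))
      ^^ snd (prod_decode (snd (prod_decode w))))
      (prod_encode (push 0 (E z) 0, fst (prod_decode w)))" for z w
  have S_apply: "S z (prod_encode (x, prod_encode (t, s))) =
      (step (Q z t) ^^ s) (prod_encode (push 0 (E z) 0, x))" for z x t s
    by (simp add: S_def)
  have "uniformly_computable S"
    unfolding S_def push_def by (intro uc_funpow uc_step answers E uc_basic)
  then obtain h r where h: "\<And>z w. run z h w = Some (fst (prod_decode (S z w)))"
    and r: "\<And>z w. run z r w = Some (snd (prod_decode (S z w)))"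
    using uc_fst uc_snd unfolding uniformly_computable_def by metis
  show thesis
  proof
    fix z x t v
    assume "run (Q z t) (prog_of (E z)) x = Some v"
    then have "reaches (Q z t) (push 0 (E z) 0) x 0 v" by (rule reaches_run)
    then obtain s where s: "(step (Q z t) ^^ s) (prod_encode (push 0 (E z) 0, x)) = prod_encode (0, v)"
      unfolding reaches_def by blast
    let ?halts = "\<lambda>n. fst (prod_decode (S z (prod_encode (x, n)))) = 0"
    let ?found = "\<lambda>n. run z h (prod_encode (x, n)) = Some 0 \<and>
      (\<forall>m<n. \<exists>v. run z h (prod_encode (x, m)) = Some (Suc v))"
    have "?halts (prod_encode (t, s))" by (simp add: S_apply s)
    then have "?halts (LEAST n. ?halts n)" by (rule LeastI)
    moreover have "\<exists>u. fst (prod_decode (S z (prod_encode (x, m)))) = Suc u"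
      if "m < (LEAST n. ?halts n)" for m
      using not_less_Least[OF that] not0_implies_Suc by blast
    ultimately have "?found (LEAST n. ?halts n)" by (simp add: h)
    then have ex: "\<exists>n. ?found n" by blast
    define n where "n = (LEAST n. ?found n)"
    have "?found n" unfolding n_def using ex by (rule LeastI_ex)
    then have halts: "?halts n" by (simp add: h)
    have mu: "run z (Mu h) x = Some n" using ex by (simp add: n_def)
    define t0 where "t0 = fst (prod_decode n)"
    define s0 where "s0 = snd (prod_decode n)"
    define v0 where "v0 = snd (prod_decode (S z (prod_encode (x, n))))"
    have n: "n = prod_encode (t0, s0)" by (simp add: t0_def s0_def)
    have "S z (prod_encode (x, n)) = prod_encode (0, v0)"
      using halts unfolding v0_def by (metis prod.collapse prod_decode_inverse)
    then have halt: "reaches (Q z t0) (push 0 (E z) 0) x 0 v0"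
      unfolding reaches_def n S_apply by blast
    have "run z (Comp r (Pair prog_id (Mu h))) x = Some v0"
      using mu by (simp add: run_id r v0_def del: run.simps(9))
    moreover have "u = v0" if "run (Q z t0) (prog_of (E z)) x = Some u" for u
      using halting_value_unique[OF reaches_run[OF that] halt] .
    ultimately show "\<exists>t v. run z (Comp r (Pair prog_id (Mu h))) x = Some v \<and>
        (\<forall>u. run (Q z t) (prog_of (E z)) x = Some u \<longrightarrow> u = v)" by blast
  qed
qed

text \<open>The dovetailed search with an oracle that does not depend on \<open>t\<close> only searches for the number of
  steps.\<close>

lemma universal_functional:
  obtains c where "\<And>e p r. Phi e p = Some r \<Longrightarrow> functional c (case_nat e p) = Some r"
proof -
  have answers: "uniformly_computable (\<lambda>z w. z (Suc (B z w)))" if "uniformly_computable B" for B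
    using that by (intro uc_basic)
  have E: "uniformly_computable (\<lambda>z w. z 0)" by (intro uc_basic)
  obtain c where c: "\<And>z x v. run (\<lambda>n. z (Suc n)) (prog_of (z 0)) x = Some v \<Longrightarrow>
      \<exists>v. run z c x = Some v \<and> (\<forall>u. run (\<lambda>n. z (Suc n)) (prog_of (z 0)) x = Some u \<longrightarrow> u = v)"
    using dovetailed_search[where Q = "\<lambda>z t n. z (Suc n)" and E = "\<lambda>z. z 0", OF answers E]
    by metis
  show thesis
  proof
    fix e p r
    assume "Phi e p = Some r"
    then have "run p (prog_of e) n = Some (r n)" for n
      by (simp add: Phi_def functional_Some_iff)
    then have "run (case_nat e p) c n = Some (r n)" for n
      using c[of "case_nat e p" n] by fastforce
    then show "functional c (case_nat e p) = Some r" by (simp add: functional_Some_iff)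
  qed
qed


section \<open>Continuity and a dense sequence\<close>

text \<open>A halting computation asks finitely many oracle questions. For \<open>Mu\<close> the tests up to the result are
  finitely many computations, and the maximum of their bounds suffices.\<close>

lemma run_depends_on_finite_prefix:
  assumes "run p c x = Some v"
  shows "\<exists>N. \<forall>q. (\<forall>n<N. q n = p n) \<longrightarrow> run q c x = Some v"
  using assms
proof (induction c arbitrary: x v)
  case Oracle
  then show ?case by (intro exI[of _ "Suc x"]) simp
next
  case (Pair c d)
  then obtain u w where u: "run p c x = Some u" and w: "run p d x = Some w"
    and v: "v = prod_encode (u, w)" by (auto simp: bind_eq_Some_conv)
  obtain M N where "\<And>q. \<forall>n<M. q n = p n \<Longrightarrow> run q c x = Some u"
    and "\<And>q. \<forall>n<N. q n = p n \<Longrightarrow> run q d x = Some w"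
    using Pair.IH(1)[OF u] Pair.IH(2)[OF w] by blast
  then show ?case by (intro exI[of _ "max M N"]) (simp add: v)
next
  case (Comp c d)
  then obtain u where u: "run p d x = Some u" and w: "run p c u = Some v"
    by (auto simp: bind_eq_Some_conv)
  obtain M N where "\<And>q. \<forall>n<M. q n = p n \<Longrightarrow> run q d x = Some u"
    and "\<And>q. \<forall>n<N. q n = p n \<Longrightarrow> run q c u = Some v"
    using Comp.IH(2)[OF u] Comp.IH(1)[OF w] by blast
  then show ?case by (intro exI[of _ "max M N"]) simp
next
  case (Rec c d)
  have "\<exists>N. \<forall>q. (\<forall>n<N. q n = p n) \<longrightarrow> run q (Rec c d) (prod_encode (a, m)) = Some v"
    if "run p (Rec c d) (prod_encode (a, m)) = Some v" for a m v
    using that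
  proof (induction m arbitrary: v)
    case 0
    then show ?case using Rec.IH(1) by simp
  next
    case (Suc m)
    then obtain u where u: "run p (Rec c d) (prod_encode (a, m)) = Some u"
      and w: "run p d (prod_encode (a, prod_encode (m, u))) = Some v"
      by (auto simp: bind_eq_Some_conv)
    obtain M N where "\<And>q. \<forall>n<M. q n = p n \<Longrightarrow> run q (Rec c d) (prod_encode (a, m)) = Some u"
      and "\<And>q. \<forall>n<N. q n = p n \<Longrightarrow> run q d (prod_encode (a, prod_encode (m, u))) = Some v"
      using Suc.IH[OF u] Rec.IH(2)[OF w] by blast
    then show ?case by (intro exI[of _ "max M N"]) simp
  qed
  from this[of "fst (prod_decode x)" "snd (prod_decode x)"] Rec.prems show ?case by simp
next
  case (Mu c)
  let ?found = "\<lambda>q n. run q c (prod_encode (x, n)) = Some 0 \<and>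
    (\<forall>m<n. \<exists>v. run q c (prod_encode (x, m)) = Some (Suc v))"
  have ex: "\<exists>n. ?found p n" and v: "v = (LEAST n. ?found p n)"
    using Mu.prems by (auto simp: Let_def split: if_splits)
  have found: "?found p v" unfolding v using ex by (rule LeastI_ex)
  have "\<exists>u. run p c (prod_encode (x, m)) = Some u" if "m \<le> v" for m
    using found that by (cases "m = v") (blast, metis le_neq_implies_less)
  then have "\<exists>N. \<forall>q. (\<forall>n<N. q n = p n) \<longrightarrow>
      run q c (prod_encode (x, m)) = run p c (prod_encode (x, m))" if "m \<le> v" for m
    using Mu.IH that by metis
  then obtain N where N: "\<And>m q. m \<le> v \<Longrightarrow> \<forall>n<N m. q n = p n \<Longrightarrow>
      run q c (prod_encode (x, m)) = run p c (prod_encode (x, m))" by metis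
  have "run q (Mu c) x = Some v" if q: "\<forall>n<Max (N ` {..v}). q n = p n" for q
  proof -
    have prefix: "\<forall>n<N m. q n = p n" if "m \<le> v" for m
      using q that by (meson Max_ge atMost_iff finite_atMost finite_imageI imageI less_le_trans)
    have same: "run q c (prod_encode (x, m)) = run p c (prod_encode (x, m))" if "m \<le> v" for m
      by (rule N[OF that prefix[OF that]])
    have found_q: "?found q v" using found by (auto simp: same)
    have "v \<le> n" if "?found q n" for n
    proof (rule ccontr)
      assume "\<not> v \<le> n"
      then have "\<exists>u. run q c (prod_encode (x, n)) = Some (Suc u)" using found_q by simp
      with that show False by simp
    qed
    then have "(LEAST n. ?found q n) = v"
      using Least_equality[where P = "?found q", OF found_q] by blast
    moreover have "\<exists>n. ?found q n" using found_q by (rule exI)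
    ultimately show ?thesis unfolding run.simps Let_def by simp
  qed
  then show ?case by blast
qed auto

text \<open>Every number codes a point of Baire space, read off by iterated unpairing. Being total in \<open>t\<close>, this
  gives a uniformly computable dense sequence.\<close>

definition stream :: "nat \<Rightarrow> baire" where
  "stream t n = fst (prod_decode (((\<lambda>m. snd (prod_decode m)) ^^ n) t))"

lemma uc_stream:
  assumes "uniformly_computable T" "uniformly_computable N"
  shows "uniformly_computable (\<lambda>z w. stream (T z w) (N z w))"
  unfolding stream_def by (intro uc_fst uc_funpow assms uc_snd uc_arg)

lemma stream_dense: "\<exists>t. \<forall>n<N. stream t n = q n"
proof (induction N arbitrary: q)
  case (Suc N)
  obtain t where t: "\<And>n. n < N \<Longrightarrow> stream t n = q (Suc n)"
    using Suc[of "\<lambda>n. q (Suc n)"] by blast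
  have "stream (prod_encode (q 0, t)) n = q n" if "n < Suc N" for n
  proof (cases n)
    case (Suc m)
    have "stream (prod_encode (q 0, t)) (Suc m) = stream t m"
      unfolding stream_def funpow_Suc_right by simp
    then show ?thesis using t that Suc by simp
  qed (simp add: stream_def)
  then show ?case by blast
qed simp

lemma run_on_stream:
  assumes "run (bpair p q) c x = Some v"
  shows "\<exists>t. run (bpair p (stream t)) c x = Some v"
proof -
  obtain N where N: "\<And>r. \<forall>n<N. r n = bpair p q n \<Longrightarrow> run r c x = Some v"
    using run_depends_on_finite_prefix[OF assms] by blast
  obtain t where "\<forall>n<N. stream t n = q n" using stream_dense by blast
  then have "\<forall>n<N. bpair p (stream t) n = bpair p q n" by (auto simp: bpair_def)
  then show ?thesis using N by blast
qed


section \<open>The tot-jump\<close>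

lemma tJ_btriple: "tJ f (btriple x) = tJ_at f x"
  using bij_btriple by (simp add: tJ_def bij_is_inj)

lemma tJ_total: "tJ f x \<noteq> {}"
proof -
  obtain e i p where "x = btriple (e, i, p)"
    using bij_btriple by (metis bij_pointE prod_cases3)
  then show ?thesis by (auto simp: tJ_btriple tJ_at_def pdom_def split: option.splits)
qed

lemma tJ_defined:
  assumes "Phi e p = Some r" "r \<in> pdom f" "\<And>q. q \<in> f r \<Longrightarrow> Phi i (bpair p q) \<noteq> None"
  shows "tJ f (btriple (e, i, p)) = {s. \<exists>q\<in>f r. Phi i (bpair p q) = Some s}"
  using assms by (simp add: tJ_btriple tJ_at_def)

lemma tJ_not_UNIV:
  assumes "tJ f (btriple (e, i, p)) \<noteq> UNIV"
  obtains r where "Phi e p = Some r" "r \<in> pdom f"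
    "\<And>q. q \<in> f r \<Longrightarrow> \<exists>s. Phi i (bpair p q) = Some s \<and> s \<in> tJ f (btriple (e, i, p))"
proof -
  have "Phi e p \<noteq> None" using assms by (auto simp: tJ_btriple tJ_at_def)
  then obtain r where r: "Phi e p = Some r" by blast
  have good: "r \<in> pdom f" "\<forall>q\<in>f r. Phi i (bpair p q) \<noteq> None"
    using assms r by (auto simp: tJ_btriple tJ_at_def split: if_splits)
  show thesis
  proof
    show "Phi e p = Some r" "r \<in> pdom f" by fact+
    show "\<exists>s. Phi i (bpair p q) = Some s \<and> s \<in> tJ f (btriple (e, i, p))" if "q \<in> f r" for q
      using tJ_defined[OF r good(1)] good(2) that by blast
  qed
qed

lemma wleE:
  assumes "f \<le>\<^sub>W g"
  obtains a b where "\<And>p. p \<in> pdom f \<Longrightarrow> \<exists>r. functional a p = Some r \<and> r \<in> pdom g \<and>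
      (\<forall>q\<in>g r. \<exists>s. functional b (bpair p q) = Some s \<and> s \<in> f p)"
  using assms unfolding wle_def partial_computable_def by blast

lemma wleI:
  assumes "\<And>p. p \<in> pdom f \<Longrightarrow> \<exists>r. functional a p = Some r \<and> r \<in> pdom g \<and>
      (\<forall>q\<in>g r. \<exists>s. functional b (bpair p q) = Some s \<and> s \<in> f p)"
  shows "f \<le>\<^sub>W g"
  using assms unfolding wle_def partial_computable_def by blast

text \<open>The two halves of evaluating \<open>tJ g\<close> at a question \<open>(e, i, p)\<close>: this one finds the question for \<open>g\<close>, and the
  next one turns an answer \<open>q\<close> of \<open>g\<close> into an answer to \<open>(e, i, p)\<close>. The codes \<open>e\<close> and \<open>i\<close> are part of the
  oracle.\<close>

lemma apply_forward:
  obtains c where "\<And>e i p r. Phi e p = Some r \<Longrightarrow> functional c (btriple (e, i, p)) = Some r"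
proof -
  obtain u where u: "\<And>e p r. Phi e p = Some r \<Longrightarrow> functional u (case_nat e p) = Some r"
    using universal_functional by blast
  have "uniformly_computable (\<lambda>z w. case_nat (z 0) (\<lambda>n. z (Suc (Suc n))) w)"
    by (intro uc_basic)
  then obtain k where k: "\<And>z. functional k z = Some (\<lambda>w. case_nat (z 0) (\<lambda>n. z (Suc (Suc n))) w)"
    using uc_functional by blast
  have "functional k (btriple (e, i, p)) = Some (case_nat e p)" for e i p
    by (simp add: k btriple_def fun_eq_iff split: nat.splits)
  then show thesis using that[of "subst_oracle k u"] u by (simp add: functional_subst_oracle)
qed

lemma apply_backward:
  obtains c where "\<And>e i p q s. Phi i (bpair p q) = Some s \<Longrightarrow>
      functional c (bpair (btriple (e, i, p)) q) = Some s"
proof -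
  obtain u where u: "\<And>e p r. Phi e p = Some r \<Longrightarrow> functional u (case_nat e p) = Some r"
    using universal_functional by blast
  \<comment> \<open>In \<open>bpair (btriple (e, i, p)) q\<close> the entry at \<open>2\<close> is \<open>i\<close>, and \<open>p\<close> starts at the entry at \<open>4\<close>.\<close>
  have "uniformly_computable (\<lambda>z w. case_nat (z 2)
      (\<lambda>n. bpair (\<lambda>m. z (2 * Suc (Suc m))) (\<lambda>m. z (Suc (2 * m))) n) w)"
    by (intro uc_basic uc_double)
  then obtain k where k: "\<And>z. functional k z = Some (\<lambda>w. case_nat (z 2)
      (\<lambda>n. bpair (\<lambda>m. z (2 * Suc (Suc m))) (\<lambda>m. z (Suc (2 * m))) n) w)"
    using uc_functional by blast
  have "functional k (bpair (btriple (e, i, p)) q) = Some (case_nat i (bpair p q))" for e i p q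
    by (simp add: k btriple_def bpair_def fun_eq_iff split: nat.splits)
  then show thesis using that[of "subst_oracle k u"] u by (simp add: functional_subst_oracle)
qed

abbreviation left :: prog where "left \<equiv> Comp Oracle prog_dbl"
abbreviation right :: prog where "right \<equiv> Comp Oracle (Comp Succ prog_dbl)"

text \<open>A question \<open>x = (e, i, p)\<close> for \<open>tJ f\<close> becomes \<open>(E, I, x)\<close> with fixed \<open>E\<close> and \<open>I\<close>: \<open>\<Phi>\<^sub>E\<close> computes the question
  \<open>\<Phi>\<^sub>e(p)\<close> for \<open>f\<close> and translates it for \<open>g\<close>, and \<open>\<Phi>\<^sub>I\<close> translates the answer back and applies \<open>\<Phi>\<^sub>i\<close>. Every answer
  to the new question is then an answer to \<open>x\<close>: this is trivial if \<open>x\<close> allows all answers, and otherwise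
  all the computations involved are defined.\<close>

lemma tJ_mono:
  assumes "f \<le>\<^sub>W g"
  shows "tJ f \<le>\<^sub>W tJ g"
proof -
  obtain a b where ab: "\<And>p. p \<in> pdom f \<Longrightarrow> \<exists>r. functional a p = Some r \<and> r \<in> pdom g \<and>
      (\<forall>q\<in>g r. \<exists>s. functional b (bpair p q) = Some s \<and> s \<in> f p)"
    using wleE[OF assms] by blast
  obtain u where u: "\<And>e i p r. Phi e p = Some r \<Longrightarrow> functional u (btriple (e, i, p)) = Some r"
    using apply_forward by blast
  obtain w where w: "\<And>e i p q s. Phi i (bpair p q) = Some s \<Longrightarrow>
      functional w (bpair (btriple (e, i, p)) q) = Some s"
    using apply_backward by blast
  define E where "E = prog_code (subst_oracle u a)"
  define B where "B = subst_oracle (prog_bpair (subst_oracle left u) right) b"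
  define I where "I = prog_code (subst_oracle (prog_bpair left B) w)"
  have "uniformly_computable (\<lambda>z n. case_nat E (\<lambda>m. case_nat I (\<lambda>k. z k) m) n)"
    by (intro uc_basic)
  then obtain k where "\<And>z. functional k z = Some (\<lambda>n. case_nat E (\<lambda>m. case_nat I (\<lambda>k. z k) m) n)"
    using uc_functional by blast
  then have k: "functional k z = Some (btriple (E, I, z))" for z
    by (simp add: btriple_def)
  have sub: "tJ g (btriple (E, I, x)) \<subseteq> tJ f x" for x
  proof (cases "tJ f x = UNIV")
    case False
    obtain e i p where x: "x = btriple (e, i, p)"
      using bij_btriple by (metis bij_pointE prod_cases3)
    obtain r where r: "Phi e p = Some r" "r \<in> pdom f"
      and i: "\<And>q. q \<in> f r \<Longrightarrow> \<exists>s. Phi i (bpair p q) = Some s \<and> s \<in> tJ f x"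
      using tJ_not_UNIV[OF False[unfolded x]] x by metis
    obtain y where y: "functional a r = Some y" "y \<in> pdom g"
      and b: "\<And>q. q \<in> g y \<Longrightarrow> \<exists>s. functional b (bpair r q) = Some s \<and> s \<in> f r"
      using ab[OF r(2)] by blast
    have ux: "functional u x = Some r" using u r x by blast
    have E: "Phi E x = Some y"
      using y by (simp add: Phi_def E_def prog_of_prog_code functional_subst_oracle[OF ux])
    have I: "\<exists>s. Phi I (bpair x q) = Some s \<and> s \<in> tJ f x" if q: "q \<in> g y" for q
    proof -
      obtain v where v: "functional b (bpair r q) = Some v" "v \<in> f r" using b[OF q] by blast
      obtain s where s: "Phi i (bpair p v) = Some s" "s \<in> tJ f x" using i[OF v(2)] by blast
      have "functional (subst_oracle left u) (bpair x q) = Some r"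
        using functional_subst_oracle[OF functional_left] ux by simp
      from functional_subst_oracle[OF functional_bpair[OF this functional_right]] v
      have "functional B (bpair x q) = Some v" by (simp add: B_def)
      from functional_subst_oracle[OF functional_bpair[OF functional_left this]]
      have "Phi I (bpair x q) = functional w (bpair x v)"
        by (simp add: Phi_def I_def prog_of_prog_code)
      also have "\<dots> = Some s" unfolding x by (rule w[OF s(1)])
      finally show ?thesis using s(2) by blast
    qed
    have "tJ g (btriple (E, I, x)) = {s. \<exists>q\<in>g y. Phi I (bpair x q) = Some s}"
      using I by (intro tJ_defined E y) fastforce
    also have "\<dots> \<subseteq> tJ f x" using I by fastforce
    finally show ?thesis .
  qed simp
  show ?thesis
  proof (rule wleI)
    show "\<exists>r. functional k x = Some r \<and> r \<in> pdom (tJ g) \<and>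
        (\<forall>q\<in>tJ g r. \<exists>s. functional right (bpair x q) = Some s \<and> s \<in> tJ f x)" for x
      using sub[of x] by (auto simp: k functional_right pdom_def tJ_total)
  qed
qed

text \<open>The value \<open>y\<close> found by the search does not depend on \<open>q\<close>, because the search runs
  on the left component of its input alone; this is essential for the contradiction, where \<open>y\<close> is
  compared with an output of \<open>\<Phi>\<^sub>i\<close> for an unknown \<open>q\<close>.\<close>

lemma tJ_reflects_wle:
  assumes "tJ f \<le>\<^sub>W tJ g"
  shows "f \<le>\<^sub>W g"
proof -
  have total: "x \<in> pdom (tJ f)" for x
    by (simp add: pdom_def tJ_total)
  obtain a b where "\<And>x. x \<in> pdom (tJ f) \<Longrightarrow> \<exists>r. functional a x = Some r \<and> r \<in> pdom (tJ g) \<and>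
      (\<forall>q\<in>tJ g r. \<exists>s. functional b (bpair x q) = Some s \<and> s \<in> tJ f x)"
    using wleE[OF assms] by blast
  then have ab: "\<exists>r. functional a x = Some r \<and>
      (\<forall>q\<in>tJ g r. \<exists>s. functional b (bpair x q) = Some s \<and> s \<in> tJ f x)" for x
    using total by blast
  define e where "e = prog_code (Comp Oracle Succ)"
  have Phi_e: "Phi e (case_nat i p) = Some p" for i p
    unfolding Phi_def e_def prog_of_prog_code by (simp add: functional_Some_iff)
  have answers: "uniformly_computable (\<lambda>z w. bpair (btriple (e, z 0, z)) (stream (A z w)) (B z w))"
    if "uniformly_computable A" "uniformly_computable B" for A B
    unfolding btriple_def case_prod_conv
    by (intro uc_basic uc_stream uc_comp[OF that(1)] that)
  \<comment> \<open>The oracle \<open>z\<close> of the search is \<open>case_nat i p\<close>, so \<open>z 0\<close> is the code of the diagonalizing program.\<close>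
  obtain c where c: "\<And>z t v. run (bpair (btriple (e, z 0, z)) (stream t)) b 0 = Some v \<Longrightarrow>
      \<exists>t v. run z c 0 = Some v \<and>
        (\<forall>u. run (bpair (btriple (e, z 0, z)) (stream t)) b 0 = Some u \<longrightarrow> u = v)"
    using dovetailed_search[where Q = "\<lambda>z t. bpair (btriple (e, z 0, z)) (stream t)"
        and E = "\<lambda>z. prog_code b", OF answers uc_const]
    unfolding prog_of_prog_code by metis
  define i where "i = prog_code (Pair (Comp Succ (Comp (subst_oracle left c) Zero)) right)"
  define X where "X p = btriple (e, i, case_nat i p)" for p
  have "uniformly_computable (\<lambda>z n. case_nat e (\<lambda>m. case_nat i (\<lambda>j. case_nat i (\<lambda>k. z k) j) m) n)"
    by (intro uc_basic)
  then obtain k where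
    "\<And>z. functional k z = Some (\<lambda>n. case_nat e (\<lambda>m. case_nat i (\<lambda>j. case_nat i (\<lambda>k. z k) j) m) n)"
    using uc_functional by blast
  then have k: "functional k p = Some (X p)" for p
    by (simp add: X_def btriple_def)
  obtain u where u: "\<And>e i p r. Phi e p = Some r \<Longrightarrow> functional u (btriple (e, i, p)) = Some r"
    using apply_forward by blast
  obtain w where w: "\<And>e i p q s. Phi i (bpair p q) = Some s \<Longrightarrow>
      functional w (bpair (btriple (e, i, p)) q) = Some s"
    using apply_backward by blast
  define A where "A = subst_oracle k a"
  define V where "V = subst_oracle (prog_bpair (subst_oracle left A) right) w"
  define S where "S = subst_oracle (prog_bpair (subst_oracle left k) V) b"
  show ?thesis
  proof (rule wleI)
    fix p
    assume p: "p \<in> pdom f"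
    obtain r where r: "functional a (X p) = Some r"
      and b: "\<And>q. q \<in> tJ g r \<Longrightarrow> \<exists>s. functional b (bpair (X p) q) = Some s \<and> s \<in> tJ f (X p)"
      using ab by blast
    obtain q s where "q \<in> tJ g r" "functional b (bpair (X p) q) = Some s"
      using b tJ_total by (metis all_not_in_conv)
    then have "run (bpair (X p) q) b 0 = Some (s 0)" by (simp add: functional_Some_iff)
    then obtain t0 where "run (bpair (X p) (stream t0)) b 0 = Some (s 0)"
      using run_on_stream by blast
    then have "\<exists>t y. run (case_nat i p) c 0 = Some y \<and>
        (\<forall>v. run (bpair (X p) (stream t)) b 0 = Some v \<longrightarrow> v = y)"
      using c[of "case_nat i p" t0 "s 0"] by (simp add: X_def)
    then obtain t y where y: "run (case_nat i p) c 0 = Some y"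
      and t: "\<And>v. run (bpair (X p) (stream t)) b 0 = Some v \<Longrightarrow> v = y"
      by blast
    have "functional (prog_of i) (bpair (case_nat i p) q) = Some (\<lambda>n. prod_encode (Suc y, q n))" for q
      using y run_subst_oracle[OF functional_left, of "case_nat i p" q c]
        functional_right[of "case_nat i p" q]
      unfolding i_def prog_of_prog_code by (simp add: functional_Some_iff)
    then have Phi_i: "Phi i (bpair (case_nat i p) q) = Some (\<lambda>n. prod_encode (Suc y, q n))" for q
      by (simp add: Phi_def)
    have tJ_X: "tJ f (X p) = {s. \<exists>q\<in>f p. s = (\<lambda>n. prod_encode (Suc y, q n))}"
      using tJ_defined[OF Phi_e p, of i i] Phi_i by (auto simp: X_def)
    \<comment> \<open>Otherwise \<open>stream t\<close> is an answer to \<open>r\<close>, and \<open>b\<close> maps it to a sequence that starts with \<open>y\<close>.\<close>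
    have "tJ g r \<noteq> UNIV"
    proof
      assume "tJ g r = UNIV"
      then obtain s where s: "functional b (bpair (X p) (stream t)) = Some s" "s \<in> tJ f (X p)"
        using b by blast
      then have "s 0 = y" by (intro t) (simp add: functional_Some_iff)
      moreover obtain q where "s 0 = prod_encode (Suc y, q)" using s(2) tJ_X by auto
      ultimately show False using le_prod_encode_1[of "Suc y" q] by simp
    qed
    moreover obtain e' i' p' where r': "r = btriple (e', i', p')"
      using bij_btriple by (metis bij_pointE prod_cases3)
    ultimately obtain r0 where r0: "Phi e' p' = Some r0" "r0 \<in> pdom g"
      and i': "\<And>q. q \<in> g r0 \<Longrightarrow> \<exists>v. Phi i' (bpair p' q) = Some v \<and> v \<in> tJ g r"
      using tJ_not_UNIV by metis
    have A: "functional A p = Some r" by (simp add: A_def functional_subst_oracle[OF k] r)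
    have "\<exists>s. functional (subst_oracle S (Comp Snd Oracle)) (bpair p q) = Some s \<and> s \<in> f p"
      if q: "q \<in> g r0" for q
    proof -
      obtain v where v: "Phi i' (bpair p' q) = Some v" "v \<in> tJ g r" using i'[OF q] by blast
      obtain s where s: "functional b (bpair (X p) v) = Some s" "s \<in> tJ f (X p)"
        using b[OF v(2)] by blast
      obtain q' where q': "q' \<in> f p" "s = (\<lambda>n. prod_encode (Suc y, q' n))"
        using s(2) tJ_X by blast
      have "functional (subst_oracle left A) (bpair p q) = Some r"
        using functional_subst_oracle[OF functional_left] A by simp
      from functional_subst_oracle[OF functional_bpair[OF this functional_right]] w[OF v(1)]
      have V: "functional V (bpair p q) = Some v" by (simp add: V_def r')
      have "functional (subst_oracle left k) (bpair p q) = Some (X p)"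
        using functional_subst_oracle[OF functional_left] k by simp
      from functional_subst_oracle[OF functional_bpair[OF this V]] s(1)
      have "functional S (bpair p q) = Some s" by (simp add: S_def)
      moreover have "functional (Comp Snd Oracle) s = Some q'"
        by (simp add: functional_Some_iff q')
      ultimately have "functional (subst_oracle S (Comp Snd Oracle)) (bpair p q) = Some q'"
        by (simp only: functional_subst_oracle)
      then show ?thesis using q'(1) by blast
    qed
    moreover have "functional (subst_oracle A u) p = Some r0"
      using functional_subst_oracle[OF A] u[OF r0(1)] r' by simp
    ultimately show "\<exists>r. functional (subst_oracle A u) p = Some r \<and> r \<in> pdom g \<and>
        (\<forall>q\<in>g r. \<exists>s. functional (subst_oracle S (Comp Snd Oracle)) (bpair p q) = Some s \<and> s \<in> f p)"
      using r0(2) by blast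
  qed
qed

theorem theorem3p7:
  shows "(\<forall>f g :: problem. tJ f \<le>\<^sub>W tJ g \<longrightarrow> f \<le>\<^sub>W g) \<and>
    (\<exists>J :: wdegree \<Rightarrow> wdegree. (\<forall>f. J (wdeg f) = wdeg (tJ f)) \<and> mono J \<and> inj J)"
proof
  show "\<forall>f g :: problem. tJ f \<le>\<^sub>W tJ g \<longrightarrow> f \<le>\<^sub>W g"
    using tJ_reflects_wle by blast
  have le: "tJ f \<le>\<^sub>W tJ g \<longleftrightarrow> f \<le>\<^sub>W g" for f g
    using tJ_mono tJ_reflects_wle by blast
  define J where "J d = wdeg (tJ (inv wdeg d))" for d
  have rep: "wdeg (inv wdeg d) = d" for d
    by (rule surj_f_inv_f[OF surj_wdeg])
  have J_le: "J d \<le> J d' \<longleftrightarrow> d \<le> d'" for d d'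
    unfolding J_def wdeg_le_iff le by (simp add: rep flip: wdeg_le_iff)
  have "J (wdeg f) = wdeg (tJ f)" for f
    using rep[of "wdeg f"] by (simp add: J_def wdeg_eq_iff weq_def le)
  moreover have "mono J" by (rule monoI) (simp add: J_le)
  moreover have "inj J" by (rule injI) (metis J_le order.antisym order.refl)
  ultimately show "\<exists>J :: wdegree \<Rightarrow> wdegree. (\<forall>f. J (wdeg f) = wdeg (tJ f)) \<and> mono J \<and> inj J"
    by blast
qed

end
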